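(* Let $c$ be a well-formed RGA term, $s\in\mathbb N$, and suppose $c\Downarrow_s\mathsf{tt}$. Then $\emptyset\vdash c$ is derivable in RGA.
   Context: **Terms.** Raw terms are: variables $v_i$ ($i\in\mathbb N$, de Bruijn indices), and operator nodes, each consisting of an operator code, a binder count $k\in\mathbb N$ and a finite list of raw terms as arguments, in each of which the $k$ lowest indices are bound. RGA has ten operators: constants $\bot$, $\mathbf 0$, $\mathcal R$ (recursor), $\mathcal A$ (universal quantifier combinator); unary $\mathbf S$, $\neg$; unary $\lambda$ (binder count 1, the only binder); binary $=$, $\lor$, and application $\cdot$ (left associative). A term $t$ is well-formed, $\mathrm{wf}(t)$, iff it is built from variables and these ten operators at these arities and binder counts. "Term" means raw term; formulas are just terms. Closed means having no free variables. $\underline n=\mathbf S^n\mathbf 0$ is the numeral of $n$. $[v_i\mapsto s]t$ (also $[i\mapsto s]t$): capture-avoiding replacement of the free variable $v_i$ by $s$, other free variables unchanged. $b[t]$: $\beta$-instance, replacing index $0$ in $b$ by $t$ and decrementing all other free indices. $\uparrow t$: all free indices increased by one; $\uparrow\Gamma$ elementwise. $\mathrm{fv}$: set of free variables. Abbreviations: $t\neq u:=\neg(t=u)$; $t\,\mathsf N:=(t=t)$; $t\,\mathsf B:=(t\lor\neg t)$; $t\land u:=\neg(\neg t\lor\neg u)$. **Head steps** $t\triangleright t'$ (syntactic relation): $(\lambda b)\cdot t\triangleright b[t]$ if $\mathrm{wf}(t)$; $\mathcal R\cdot g\cdot h\cdot\mathbf 0\triangleright g$ if $\mathrm{wf}(h)$;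 $\mathcal R\cdot g\cdot h\cdot(\mathbf S\,\underline n)\triangleright h\cdot\underline n\cdot(\mathcal R\cdot g\cdot h\cdot\underline n)$ if $\mathrm{wf}(g)$; and $t\cdot u\triangleright t'\cdot u$ if $t\triangleright t'$. **Proofs.** A judgment $\Gamma\vdash c$ has a finite set $\Gamma$ of terms and a term $c$. A proof is a finite list of judgments each following from earlier entries by one rule below; $P\rhd(\Gamma\vdash c)$ means $P$ is a valid proof containing $\Gamma\vdash c$; a judgment is derivable if some proof contains it. Writing $\Gamma\vdash c$ as an assertion means derivability. Rules ($\Rightarrow$ from premises to conclusion, $\Leftrightarrow$ both directions): Structural: $\mathrm{wf}(c)\Rightarrow\Gamma,c\vdash c$; $\Gamma\vdash c\Rightarrow\Gamma,a\vdash c$; $\Gamma\vdash a$ and $\Gamma,a\vdash c\Rightarrow\Gamma\vdash c$; $\Gamma\vdash c$ with $\Gamma,c,s$ well-formed $\Rightarrow[v\mapsto s]\Gamma\vdash[v\mapsto s]c$. Truth values: $\Gamma\vdash a\Leftrightarrow\Gamma\vdash a=\underline 1$; $\Gamma\vdash\neg a\Leftrightarrow\Gamma\vdash a=\underline 0$. Negation: $\Gamma\vdash\neg a$, $\Gamma\vdash a$, $\mathrm{wf}(c)\Rightarrow\Gamma\vdash c$; $\Gamma\vdash a\Leftrightarrow\Gamma\vdash\neg\neg a$. Disjunction: $\Gamma\vdash a$, $\mathrm{wf}(b)\Rightarrow\Gamma\vdash a\lor b$; $\Gamma\vdash b$, $\mathrm{wf}(a)\Rightarrow\Gamma\vdash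 a\lor b$; $\Gamma\vdash\neg a$, $\Gamma\vdash\neg b\Rightarrow\Gamma\vdash\neg(a\lor b)$; $\Gamma\vdash a\lor b$, $\Gamma,a\vdash c$, $\Gamma,b\vdash c\Rightarrow\Gamma\vdash c$; $\Gamma\vdash\neg(a\lor b)\Rightarrow\Gamma\vdash\neg a$, and $\Rightarrow\Gamma\vdash\neg b$. Equality: $\Gamma\vdash a\,\mathsf N\Leftrightarrow\Gamma\vdash a=a$; $\Gamma\vdash a=b\Rightarrow\Gamma\vdash b=a$; $\Gamma\vdash a=b$, $\Gamma\vdash[v\mapsto a]p$, $\mathrm{wf}(p)\Rightarrow\Gamma\vdash[v\mapsto b]p$; $\Gamma\vdash a\ne b\Rightarrow\Gamma\vdash b\ne a$; $\Gamma\vdash a\,\mathsf N$, $\Gamma\vdash b\,\mathsf N\Rightarrow\Gamma\vdash(a=b)\,\mathsf B$; $\Gamma\vdash(a=b)\,\mathsf B\Rightarrow\Gamma\vdash(a\,\mathsf N)\land(b\,\mathsf N)$. Naturals: $\Gamma\vdash\mathbf 0\,\mathsf N$; $\Gamma\vdash a\,\mathsf N\Leftrightarrow\Gamma\vdash\mathbf S a\,\mathsf N$; $\Gamma\vdash a\,\mathsf N\Rightarrow\Gamma\vdash\mathbf S a\ne\mathbf 0$; $\Gamma\vdash a\ne b\Leftrightarrow\Gamma\vdash\mathbf S a\ne\mathbf S b$; $\Gamma\vdash\mathbf S a=\mathbf S b\Rightarrow\Gamma\vdash a=b$; $\Gamma\vdash\bot\,\mathsf N$, $\mathrm{wf}(p)\Rightarrow\Gamma\vdash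 p$. Induction: $\Gamma\vdash[i\mapsto\mathbf 0]c$; $v_i\,\mathsf N,c,\Gamma\vdash[i\mapsto\mathbf S v_i]c$; $\Gamma\vdash a\,\mathsf N$; $\mathrm{wf}(c)$; $i\notin\mathrm{fv}(\Gamma)$ $\Rightarrow\Gamma\vdash[i\mapsto a]c$. Conversion: if $c\triangleright c'$: $\Gamma\vdash c'\Leftrightarrow\Gamma\vdash c$; $\Gamma\vdash c'\,\mathsf N\Rightarrow\Gamma\vdash c=c'$. Recursor: $\Gamma\vdash m\,\mathsf N$, $\Gamma\vdash(h\cdot m\cdot(\mathcal R\cdot g\cdot h\cdot m))\,\mathsf N$, $\mathrm{wf}(g)\Rightarrow\Gamma\vdash\mathcal R\cdot g\cdot h\cdot(\mathbf S m)=h\cdot m\cdot(\mathcal R\cdot g\cdot h\cdot m)$. Quantifier: $v_0\,\mathsf N,\uparrow\Gamma\vdash\uparrow f\cdot v_0\Rightarrow\Gamma\vdash\mathcal A\cdot f$; $\Gamma\vdash\mathcal A\cdot f$, $\Gamma\vdash a\,\mathsf N\Rightarrow\Gamma\vdash f\cdot a$; $\Gamma\vdash\neg(f\cdot a)$, $\Gamma\vdash a\,\mathsf N\Rightarrow\Gamma\vdash\neg(\mathcal A\cdot f)$; $\Gamma\vdash\neg(\mathcal A\cdot f)$ and $v_0\,\mathsf N,\neg(\uparrow f\cdot v_0),\uparrow\Gamma\vdash\uparrow c\Rightarrow\Gamma\vdash c$. **Evaluation.** Fix a standard effective injective Gödel coding $P\mapsto\ulcorner P\urcorner\in\mathbb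 N$ of proofs. Let $\mathsf{tt}=1$, $\mathsf{ff}=0$. Head shapes $w$ are: $\lambda b$; $\mathcal R$; $\mathcal R\,g$; $\mathcal R\,g\,h$; $\mathcal A$. Value evaluation $t\Downarrow_s r$ ($r,s\in\mathbb N$) and head evaluation $t\Downarrow^{\mathrm{hd}}_s w$ are the least relations on (possibly open) terms such that for all $s$ (there are no clauses for $\bot$ or variables): Values: $\mathbf 0\Downarrow_{s+1}0$; $a\Downarrow_s n\Rightarrow\mathbf S a\Downarrow_{s+1}n+1$; $a\Downarrow_s m$, $b\Downarrow_s n\Rightarrow(a=b)\Downarrow_{s+1}\mathsf{tt}$ if $m=n$ and $\mathsf{ff}$ otherwise; $a\Downarrow_s\mathsf{ff}\Rightarrow\neg a\Downarrow_{s+1}\mathsf{tt}$; $a\Downarrow_s\mathsf{tt}\Rightarrow\neg a\Downarrow_{s+1}\mathsf{ff}$; $a\Downarrow_s\mathsf{tt}$ or $b\Downarrow_s\mathsf{tt}\Rightarrow(a\lor b)\Downarrow_{s+1}\mathsf{tt}$; $a\Downarrow_s\mathsf{ff}$ and $b\Downarrow_s\mathsf{ff}\Rightarrow(a\lor b)\Downarrow_{s+1}\mathsf{ff}$; $t\Downarrow^{\mathrm{hd}}_s\lambda b$, $b[u]\Downarrow_s r\Rightarrow t\cdot u\Downarrow_{s+1}r$; $t\Downarrow^{\mathrm{hd}}_s\mathcal R\,g\,h$, $m\Downarrow_s 0$, $g\Downarrow_s r\Rightarrow t\cdot m\Downarrow_{s+1}r$; $t\Downarrow^{\mathrm{hd}}_s\mathcal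 R\,g\,h$, $m\Downarrow_s k+1$, $h\cdot\underline k\cdot(\mathcal R\cdot g\cdot h\cdot\underline k)\Downarrow_s r\Rightarrow t\cdot m\Downarrow_{s+1}r$. Quantifier: if $t\Downarrow^{\mathrm{hd}}_s\mathcal A$ and $\ulcorner P\urcorner\le s$, then $P\rhd(\{v_0\,\mathsf N\}\vdash\uparrow u\cdot v_0)\Rightarrow t\cdot u\Downarrow_{s+1}\mathsf{tt}$, and $P\rhd(\emptyset\vdash\neg(u\cdot\underline i))$ for some $i\in\mathbb N$ $\Rightarrow t\cdot u\Downarrow_{s+1}\mathsf{ff}$. Heads: $\lambda b\Downarrow^{\mathrm{hd}}_{s+1}\lambda b$; $\mathcal R\Downarrow^{\mathrm{hd}}_{s+1}\mathcal R$; $\mathcal A\Downarrow^{\mathrm{hd}}_{s+1}\mathcal A$; $t\Downarrow^{\mathrm{hd}}_s\mathcal R\Rightarrow t\cdot g\Downarrow^{\mathrm{hd}}_{s+1}\mathcal R\,g$; $t\Downarrow^{\mathrm{hd}}_s\mathcal R\,g\Rightarrow t\cdot h\Downarrow^{\mathrm{hd}}_{s+1}\mathcal R\,g\,h$; and the three clauses for $t\cdot u$, $t\cdot m$ above (heads $\lambda b$ and $\mathcal R\,g\,h$) with the last premise and the conclusion replaced by head evaluation to the same $w$. *)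

theory Defs
  imports Main "HOL-Library.FSet"
begin

section \<open>Raw terms\<close>

text \<open>
  \<open>Op f k ts\<close> is an operator node with code \<open>f\<close> and binder count \<open>k\<close>; the indices
  \<open>0, \<dots>, k - 1\<close> are bound in each argument. Codes are natural numbers, so there are raw terms
  (for instance those with a code above 9, or with a wrong arity) that are not well-formed.
\<close>

datatype trm = Var nat | Op nat nat "trm list"

primrec shift :: "nat \<Rightarrow> nat \<Rightarrow> trm \<Rightarrow> trm" where
  "shift n d (Var i) = Var (if i < d then i else i + n)"
| "shift n d (Op f k ts) = Op f k (map (shift n (d + k)) ts)"

abbreviation up :: "trm \<Rightarrow> trm" ("\<up>_" [100] 100) where
  "\<up>t \<equiv> shift 1 0 t"

text \<open>\<open>subst i s t\<close> is $[v_i \mapsto s]t$: no index other than \<open>i\<close> is renumbered.\<close>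

primrec subst :: "nat \<Rightarrow> trm \<Rightarrow> trm \<Rightarrow> trm" where
  "subst i s (Var j) = (if j = i then s else Var j)"
| "subst i s (Op f k ts) = Op f k (map (subst (i + k) (shift k 0 s)) ts)"

text \<open>\<open>inst 0 s b\<close> is the \<open>\<beta>\<close>-instance $b[s]$.\<close>

primrec inst :: "nat \<Rightarrow> trm \<Rightarrow> trm \<Rightarrow> trm" where
  "inst i s (Var j) = (if j < i then Var j else if j = i then s else Var (j - 1))"
| "inst i s (Op f k ts) = Op f k (map (inst (i + k) (shift k 0 s)) ts)"

abbreviation beta :: "trm \<Rightarrow> trm \<Rightarrow> trm" where
  "beta b t \<equiv> inst 0 t b"

primrec fv :: "trm \<Rightarrow> nat set" where
  "fv (Var i) = {i}"
| "fv (Op f k ts) = {i. \<exists>X \<in> set (map fv ts). i + k \<in> X}"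


section \<open>The operators of RGA\<close>

abbreviation Bot :: trm where "Bot \<equiv> Op 0 0 []"
abbreviation Zero :: trm where "Zero \<equiv> Op 1 0 []"
abbreviation Rec :: trm where "Rec \<equiv> Op 2 0 []"
abbreviation All :: trm where "All \<equiv> Op 3 0 []"
abbreviation Sc :: "trm \<Rightarrow> trm" where "Sc t \<equiv> Op 4 0 [t]"
abbreviation Neg :: "trm \<Rightarrow> trm" ("\<^bold>\<not> _" [90] 90) where "\<^bold>\<not> t \<equiv> Op 5 0 [t]"
abbreviation Lam :: "trm \<Rightarrow> trm" where "Lam b \<equiv> Op 6 1 [b]"
abbreviation Eq :: "trm \<Rightarrow> trm \<Rightarrow> trm" (infix "\<doteq>" 80) where "t \<doteq> u \<equiv> Op 7 0 [t, u]"
abbreviation Or :: "trm \<Rightarrow> trm \<Rightarrow> trm" (infixr "\<^bold>\<or>" 70) where "t \<^bold>\<or> u \<equiv> Op 8 0 [t, u]"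
abbreviation App :: "trm \<Rightarrow> trm \<Rightarrow> trm" (infixl "\<cdot>" 95) where "t \<cdot> u \<equiv> Op 9 0 [t, u]"

text \<open>The triples (operator code, binder count, arity).\<close>

definition rga_sig :: "(nat \<times> nat \<times> nat) set" where
  "rga_sig = {(0, 0, 0), (1, 0, 0), (2, 0, 0), (3, 0, 0), (4, 0, 1), (5, 0, 1),
              (6, 1, 1), (7, 0, 2), (8, 0, 2), (9, 0, 2)}"

inductive wft :: "trm \<Rightarrow> bool" where
  wft_Var: "wft (Var i)"
| wft_Op: "(f, k, length ts) \<in> rga_sig \<Longrightarrow> (\<And>t. t \<in> set ts \<Longrightarrow> wft t) \<Longrightarrow> wft (Op f k ts)"

abbreviation num :: "nat \<Rightarrow> trm" where
  "num n \<equiv> (Sc ^^ n) Zero"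

abbreviation Neq :: "trm \<Rightarrow> trm \<Rightarrow> trm" (infix "\<^bold>\<noteq>" 80) where "t \<^bold>\<noteq> u \<equiv> \<^bold>\<not> (t \<doteq> u)"
abbreviation And :: "trm \<Rightarrow> trm \<Rightarrow> trm" (infixr "\<^bold>\<and>" 75) where
  "t \<^bold>\<and> u \<equiv> \<^bold>\<not> (\<^bold>\<not> t \<^bold>\<or> \<^bold>\<not> u)"
abbreviation isN :: "trm \<Rightarrow> trm" where "isN t \<equiv> t \<doteq> t"
abbreviation isB :: "trm \<Rightarrow> trm" where "isB t \<equiv> t \<^bold>\<or> \<^bold>\<not> t"

inductive hstep :: "trm \<Rightarrow> trm \<Rightarrow> bool" (infix "\<triangleright>" 50) where
  hstep_beta: "wft t \<Longrightarrow> Lam b \<cdot> t \<triangleright> beta b t"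
| hstep_zero: "wft h \<Longrightarrow> Rec \<cdot> g \<cdot> h \<cdot> Zero \<triangleright> g"
| hstep_suc:  "wft g \<Longrightarrow> Rec \<cdot> g \<cdot> h \<cdot> Sc (num n) \<triangleright> h \<cdot> num n \<cdot> (Rec \<cdot> g \<cdot> h \<cdot> num n)"
| hstep_app:  "t \<triangleright> t' \<Longrightarrow> t \<cdot> u \<triangleright> t' \<cdot> u"


section \<open>Proofs\<close>

datatype sequent = Sequent "trm fset" trm (infix "\<turnstile>" 45)

text \<open>\<open>infer js j\<close>: \<open>j\<close> follows from the premises \<open>js\<close> by one rule.\<close>

inductive infer :: "sequent list \<Rightarrow> sequent \<Rightarrow> bool" where
  \<comment> \<open>structural rules\<close>
  hyp:    "wft c \<Longrightarrow> infer [] (finsert c \<Gamma> \<turnstile> c)"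
| weaken: "infer [\<Gamma> \<turnstile> c] (finsert a \<Gamma> \<turnstile> c)"
| cut:    "infer [\<Gamma> \<turnstile> a, finsert a \<Gamma> \<turnstile> c] (\<Gamma> \<turnstile> c)"
| substitution:
    "(\<And>a. a |\<in>| \<Gamma> \<Longrightarrow> wft a) \<Longrightarrow> wft c \<Longrightarrow> wft s \<Longrightarrow>
     infer [\<Gamma> \<turnstile> c] (subst v s |`| \<Gamma> \<turnstile> subst v s c)"
  \<comment> \<open>truth values\<close>
| true_intro:  "infer [\<Gamma> \<turnstile> a] (\<Gamma> \<turnstile> a \<doteq> num 1)"
| true_elim:   "infer [\<Gamma> \<turnstile> a \<doteq> num 1] (\<Gamma> \<turnstile> a)"
| false_intro: "infer [\<Gamma> \<turnstile> \<^bold>\<not> a] (\<Gamma> \<turnstile> a \<doteq> num 0)"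
| false_elim:  "infer [\<Gamma> \<turnstile> a \<doteq> num 0] (\<Gamma> \<turnstile> \<^bold>\<not> a)"
  \<comment> \<open>negation\<close>
| neg_elim:     "wft c \<Longrightarrow> infer [\<Gamma> \<turnstile> \<^bold>\<not> a, \<Gamma> \<turnstile> a] (\<Gamma> \<turnstile> c)"
| negneg_intro: "infer [\<Gamma> \<turnstile> a] (\<Gamma> \<turnstile> \<^bold>\<not> (\<^bold>\<not> a))"
| negneg_elim:  "infer [\<Gamma> \<turnstile> \<^bold>\<not> (\<^bold>\<not> a)] (\<Gamma> \<turnstile> a)"
  \<comment> \<open>disjunction\<close>
| or_intro1:     "wft b \<Longrightarrow> infer [\<Gamma> \<turnstile> a] (\<Gamma> \<turnstile> a \<^bold>\<or> b)"
| or_intro2:     "wft a \<Longrightarrow> infer [\<Gamma> \<turnstile> b] (\<Gamma> \<turnstile> a \<^bold>\<or> b)"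
| neg_or_intro:  "infer [\<Gamma> \<turnstile> \<^bold>\<not> a, \<Gamma> \<turnstile> \<^bold>\<not> b] (\<Gamma> \<turnstile> \<^bold>\<not> (a \<^bold>\<or> b))"
| or_elim:       "infer [\<Gamma> \<turnstile> a \<^bold>\<or> b, finsert a \<Gamma> \<turnstile> c, finsert b \<Gamma> \<turnstile> c] (\<Gamma> \<turnstile> c)"
| neg_or_elim1:  "infer [\<Gamma> \<turnstile> \<^bold>\<not> (a \<^bold>\<or> b)] (\<Gamma> \<turnstile> \<^bold>\<not> a)"
| neg_or_elim2:  "infer [\<Gamma> \<turnstile> \<^bold>\<not> (a \<^bold>\<or> b)] (\<Gamma> \<turnstile> \<^bold>\<not> b)"
  \<comment> \<open>equality; the first two rules are trivial once the abbreviation \<open>isN\<close> is unfolded\<close>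
| eq_isN1:    "infer [\<Gamma> \<turnstile> isN a] (\<Gamma> \<turnstile> a \<doteq> a)"
| eq_isN2:    "infer [\<Gamma> \<turnstile> a \<doteq> a] (\<Gamma> \<turnstile> isN a)"
| eq_sym:     "infer [\<Gamma> \<turnstile> a \<doteq> b] (\<Gamma> \<turnstile> b \<doteq> a)"
| eq_replace: "wft p \<Longrightarrow> infer [\<Gamma> \<turnstile> a \<doteq> b, \<Gamma> \<turnstile> subst v a p] (\<Gamma> \<turnstile> subst v b p)"
| neq_sym:    "infer [\<Gamma> \<turnstile> a \<^bold>\<noteq> b] (\<Gamma> \<turnstile> b \<^bold>\<noteq> a)"
| eq_isB:     "infer [\<Gamma> \<turnstile> isN a, \<Gamma> \<turnstile> isN b] (\<Gamma> \<turnstile> isB (a \<doteq> b))"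
| eq_isB_isN: "infer [\<Gamma> \<turnstile> isB (a \<doteq> b)] (\<Gamma> \<turnstile> isN a \<^bold>\<and> isN b)"
  \<comment> \<open>natural numbers\<close>
| zero_isN:    "infer [] (\<Gamma> \<turnstile> isN Zero)"
| suc_isN:     "infer [\<Gamma> \<turnstile> isN a] (\<Gamma> \<turnstile> isN (Sc a))"
| suc_isN_rev: "infer [\<Gamma> \<turnstile> isN (Sc a)] (\<Gamma> \<turnstile> isN a)"
| suc_neq_0:   "infer [\<Gamma> \<turnstile> isN a] (\<Gamma> \<turnstile> Sc a \<^bold>\<noteq> Zero)"
| suc_neq:     "infer [\<Gamma> \<turnstile> a \<^bold>\<noteq> b] (\<Gamma> \<turnstile> Sc a \<^bold>\<noteq> Sc b)"
| suc_neq_rev: "infer [\<Gamma> \<turnstile> Sc a \<^bold>\<noteq> Sc b] (\<Gamma> \<turnstile> a \<^bold>\<noteq> b)"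
| suc_inj:     "infer [\<Gamma> \<turnstile> Sc a \<doteq> Sc b] (\<Gamma> \<turnstile> a \<doteq> b)"
| bot_isN:     "wft p \<Longrightarrow> infer [\<Gamma> \<turnstile> isN Bot] (\<Gamma> \<turnstile> p)"
  \<comment> \<open>induction\<close>
| induction:
    "wft c \<Longrightarrow> (\<And>t. t |\<in>| \<Gamma> \<Longrightarrow> i \<notin> fv t) \<Longrightarrow>
     infer [\<Gamma> \<turnstile> subst i Zero c,
            finsert (isN (Var i)) (finsert c \<Gamma>) \<turnstile> subst i (Sc (Var i)) c,
            \<Gamma> \<turnstile> isN a]
           (\<Gamma> \<turnstile> subst i a c)"
  \<comment> \<open>conversion\<close>
| conv_expand: "c \<triangleright> c' \<Longrightarrow> infer [\<Gamma> \<turnstile> c'] (\<Gamma> \<turnstile> c)"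
| conv_reduce: "c \<triangleright> c' \<Longrightarrow> infer [\<Gamma> \<turnstile> c] (\<Gamma> \<turnstile> c')"
| conv_eq:     "c \<triangleright> c' \<Longrightarrow> infer [\<Gamma> \<turnstile> isN c'] (\<Gamma> \<turnstile> c \<doteq> c')"
  \<comment> \<open>recursor\<close>
| recursor:
    "wft g \<Longrightarrow>
     infer [\<Gamma> \<turnstile> isN m, \<Gamma> \<turnstile> isN (h \<cdot> m \<cdot> (Rec \<cdot> g \<cdot> h \<cdot> m))]
           (\<Gamma> \<turnstile> Rec \<cdot> g \<cdot> h \<cdot> Sc m \<doteq> h \<cdot> m \<cdot> (Rec \<cdot> g \<cdot> h \<cdot> m))"
  \<comment> \<open>quantifier\<close>
| all_intro: "infer [finsert (isN (Var 0)) (up |`| \<Gamma>) \<turnstile> \<up>f \<cdot> Var 0] (\<Gamma> \<turnstile> All \<cdot> f)"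
| all_elim:  "infer [\<Gamma> \<turnstile> All \<cdot> f, \<Gamma> \<turnstile> isN a] (\<Gamma> \<turnstile> f \<cdot> a)"
| neg_all_intro: "infer [\<Gamma> \<turnstile> \<^bold>\<not> (f \<cdot> a), \<Gamma> \<turnstile> isN a] (\<Gamma> \<turnstile> \<^bold>\<not> (All \<cdot> f))"
| neg_all_elim:
    "infer [\<Gamma> \<turnstile> \<^bold>\<not> (All \<cdot> f),
            finsert (isN (Var 0)) (finsert (\<^bold>\<not> (\<up>f \<cdot> Var 0)) (up |`| \<Gamma>)) \<turnstile> \<up>c]
           (\<Gamma> \<turnstile> c)"

definition valid_proof :: "sequent list \<Rightarrow> bool" where
  "valid_proof P \<longleftrightarrow>
     (\<forall>i < length P. \<exists>js. set js \<subseteq> set (take i P) \<and> infer js (P ! i))"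

definition proves :: "sequent list \<Rightarrow> sequent \<Rightarrow> bool" (infix "\<rhd>" 40) where
  "P \<rhd> j \<longleftrightarrow> valid_proof P \<and> j \<in> set P"

definition derivable :: "sequent \<Rightarrow> bool" where
  "derivable j \<longleftrightarrow> (\<exists>P. P \<rhd> j)"


section \<open>Evaluation\<close>

datatype head = HLam trm | HRec | HRec1 trm | HRec2 trm trm | HAll

abbreviation tt :: nat where "tt \<equiv> 1"
abbreviation ff :: nat where "ff \<equiv> 0"

text \<open>
  \<open>ev gn s t r\<close> is $t \Downarrow_s r$ and \<open>hd_ev gn s t w\<close> is $t \Downarrow^{hd}_s w$, relative to
  the Goedel coding \<open>gn\<close> of proofs, which only bounds the proof search in the quantifier clauses.
\<close>

inductive ev :: "(sequent list \<Rightarrow> nat) \<Rightarrow> nat \<Rightarrow> trm \<Rightarrow> nat \<Rightarrow> bool"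
  and hd_ev :: "(sequent list \<Rightarrow> nat) \<Rightarrow> nat \<Rightarrow> trm \<Rightarrow> head \<Rightarrow> bool"
  for gn :: "sequent list \<Rightarrow> nat" where
  ev_zero: "ev gn (s + 1) Zero 0"
| ev_suc:  "ev gn s a n \<Longrightarrow> ev gn (s + 1) (Sc a) (n + 1)"
| ev_eq:   "ev gn s a m \<Longrightarrow> ev gn s b n \<Longrightarrow>
            ev gn (s + 1) (a \<doteq> b) (if m = n then tt else ff)"
| ev_neg_ff: "ev gn s a ff \<Longrightarrow> ev gn (s + 1) (\<^bold>\<not> a) tt"
| ev_neg_tt: "ev gn s a tt \<Longrightarrow> ev gn (s + 1) (\<^bold>\<not> a) ff"
| ev_or_tt1: "ev gn s a tt \<Longrightarrow> ev gn (s + 1) (a \<^bold>\<or> b) tt"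
| ev_or_tt2: "ev gn s b tt \<Longrightarrow> ev gn (s + 1) (a \<^bold>\<or> b) tt"
| ev_or_ff:  "ev gn s a ff \<Longrightarrow> ev gn s b ff \<Longrightarrow> ev gn (s + 1) (a \<^bold>\<or> b) ff"
| ev_beta: "hd_ev gn s t (HLam b) \<Longrightarrow> ev gn s (beta b u) r \<Longrightarrow> ev gn (s + 1) (t \<cdot> u) r"
| ev_rec_zero: "hd_ev gn s t (HRec2 g h) \<Longrightarrow> ev gn s m 0 \<Longrightarrow> ev gn s g r \<Longrightarrow>
                ev gn (s + 1) (t \<cdot> m) r"
| ev_rec_suc: "hd_ev gn s t (HRec2 g h) \<Longrightarrow> ev gn s m (k + 1) \<Longrightarrow>
               ev gn s (h \<cdot> num k \<cdot> (Rec \<cdot> g \<cdot> h \<cdot> num k)) r \<Longrightarrow>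
               ev gn (s + 1) (t \<cdot> m) r"
| ev_all_tt: "hd_ev gn s t HAll \<Longrightarrow> gn P \<le> s \<Longrightarrow>
              P \<rhd> ({|isN (Var 0)|} \<turnstile> \<up>u \<cdot> Var 0) \<Longrightarrow>
              ev gn (s + 1) (t \<cdot> u) tt"
| ev_all_ff: "hd_ev gn s t HAll \<Longrightarrow> gn P \<le> s \<Longrightarrow>
              P \<rhd> ({||} \<turnstile> \<^bold>\<not> (u \<cdot> num i)) \<Longrightarrow>
              ev gn (s + 1) (t \<cdot> u) ff"
| hd_lam:  "hd_ev gn (s + 1) (Lam b) (HLam b)"
| hd_rec:  "hd_ev gn (s + 1) Rec HRec"
| hd_all:  "hd_ev gn (s + 1) All HAll"
| hd_rec1: "hd_ev gn s t HRec \<Longrightarrow> hd_ev gn (s + 1) (t \<cdot> g) (HRec1 g)"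
| hd_rec2: "hd_ev gn s t (HRec1 g) \<Longrightarrow> hd_ev gn (s + 1) (t \<cdot> h) (HRec2 g h)"
| hd_beta: "hd_ev gn s t (HLam b) \<Longrightarrow> hd_ev gn s (beta b u) w \<Longrightarrow> hd_ev gn (s + 1) (t \<cdot> u) w"
| hd_rec_zero: "hd_ev gn s t (HRec2 g h) \<Longrightarrow> ev gn s m 0 \<Longrightarrow> hd_ev gn s g w \<Longrightarrow>
                hd_ev gn (s + 1) (t \<cdot> m) w"
| hd_rec_suc: "hd_ev gn s t (HRec2 g h) \<Longrightarrow> ev gn s m (k + 1) \<Longrightarrow>
               hd_ev gn s (h \<cdot> num k \<cdot> (Rec \<cdot> g \<cdot> h \<cdot> num k)) w \<Longrightarrow>
               hd_ev gn (s + 1) (t \<cdot> m) w"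

end

theory Submission
  imports Defs
begin

text \<open>
  Evaluation is reflected by provable equations: if a well-formed term \<open>t\<close> evaluates to \<open>r\<close>, then
  \<open>t \<doteq> num r\<close> is derivable. For \<open>r = 1\<close> the truth value rule then gives \<open>t\<close> itself.

  An equation is the wrong claim for head evaluation: in RGA a derivable \<open>t \<doteq> w\<close> already makes
  \<open>t\<close> and \<open>w\<close> numbers, and a head such as \<open>\<lambda>b\<close> is not meant to be one. What a head evaluation of
  \<open>t\<close> to \<open>w\<close> yields instead is that \<open>t\<close> may stand for \<open>w\<close> at the front of every application
  that has a value: if \<open>w \<cdot> u\<^sub>1 \<cdot> \<dots> \<cdot> u\<^sub>n \<doteq> num r\<close> is derivable, so is
  \<open>t \<cdot> u\<^sub>1 \<cdot> \<dots> \<cdot> u\<^sub>n \<doteq> num r\<close>. The quantification over all argument lists is what makes the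
  induction work: an application \<open>t \<cdot> u\<close> uses the hypothesis for \<open>t\<close> with the longer
  list \<open>u, u\<^sub>1, \<dots>, u\<^sub>n\<close>. Both claims are proved by simultaneous induction (lemma
  \<open>evaluation_sound\<close>).

  Two facts carry the computational cases. Head steps can be undone under a value equation
  (\<open>has_value_expand\<close>), because the conversion rule yields \<open>c \<doteq> c'\<close> as soon as \<open>c'\<close> is known
  to be a number. Head steps of the recursor fire only on literal numerals, so an argument that
  merely evaluates to a numeral is first exchanged for it by Leibniz' law
  (\<open>has_value_rec_arg\<close>). In the quantifier cases, one quantifier rule extends the proof
  that the evaluation found.
\<close>


section \<open>Substitution and well-formedness\<close>

(* Operator codes are natural numbers, and so are truth values; a 1 rewritten to Suc 0 would
   keep rules about Zero and about tt from matching. *)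
declare One_nat_def [simp del]

lemma shift_zero [simp]: "shift 0 d t = t"
proof (induction t arbitrary: d)
  case (Op f k ts)
  then show ?case by (auto intro: map_idI)
qed simp

lemma subst_not_free: "v \<notin> fv t \<Longrightarrow> subst v s t = t"
proof (induction t arbitrary: v s)
  case (Op f k ts)
  then show ?case by (auto intro!: map_idI)
qed simp

lemma finite_fv: "finite (fv t)"
proof (induction t)
  case (Op f k ts)
  have "fv (Op f k ts) = (\<Union>t \<in> set ts. (\<lambda>i. i + k) -` fv t)"
    by auto
  then show ?case
    using Op by (auto intro!: finite_vimageI injI simp del: fv.simps)
qed simp

lemma ex_fresh:
  assumes "finite T"
  obtains v where "\<And>t. t \<in> T \<Longrightarrow> v \<notin> fv t"
proof -
  have "finite (\<Union>t \<in> T. fv t)"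
    using assms finite_fv by blast
  then show thesis
    using ex_new_if_finite[OF infinite_UNIV_nat] that by blast
qed

lemma wft_shift: "wft t \<Longrightarrow> wft (shift n d t)"
proof (induction arbitrary: d rule: wft.induct)
  case (wft_Op f k ts)
  then show ?case by (auto intro!: wft.wft_Op)
qed (simp add: wft.wft_Var)

lemma wft_inst: "wft b \<Longrightarrow> wft u \<Longrightarrow> wft (inst i u b)"
proof (induction arbitrary: i u rule: wft.induct)
  case (wft_Op f k ts)
  then have "wft (inst (i + k) (shift k 0 u) t)" if "t \<in> set ts" for t
    using that wft_shift by blast
  then show ?case
    using wft_Op.hyps by (auto intro!: wft.wft_Op)
qed (auto simp: wft.wft_Var)

lemma wft_Op_iff: "wft (Op f k ts) \<longleftrightarrow> (f, k, length ts) \<in> rga_sig \<and> (\<forall>t \<in> set ts. wft t)"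
  by (auto elim: wft.cases intro: wft.intros)

lemma wft_simps [simp]:
  "wft (Var i)" "wft Zero" "wft Rec" "wft All"
  "wft (Sc a) \<longleftrightarrow> wft a" "wft (\<^bold>\<not> a) \<longleftrightarrow> wft a" "wft (Lam a) \<longleftrightarrow> wft a"
  "wft (a \<doteq> b) \<longleftrightarrow> wft a \<and> wft b" "wft (a \<^bold>\<or> b) \<longleftrightarrow> wft a \<and> wft b"
  "wft (a \<cdot> b) \<longleftrightarrow> wft a \<and> wft b"
  by (simp_all add: wft_Op_iff rga_sig_def wft.wft_Var)

lemma wft_num [simp]: "wft (num n)"
  by (induction n) auto

lemma subst_num [simp]: "subst v s (num n) = num n"
  by (induction n) auto


section \<open>Derivability\<close>

lemma valid_proof_append:
  assumes "valid_proof P" "valid_proof Q"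
  shows "valid_proof (P @ Q)"
  unfolding valid_proof_def
proof (intro allI impI)
  fix i assume i: "i < length (P @ Q)"
  show "\<exists>js. set js \<subseteq> set (take i (P @ Q)) \<and> infer js ((P @ Q) ! i)"
  proof (cases "i < length P")
    case True
    then show ?thesis
      using assms(1) by (simp add: valid_proof_def nth_append)
  next
    case False
    then have "i - length P < length Q"
      using i by simp
    then obtain js where "set js \<subseteq> set (take (i - length P) Q)" "infer js (Q ! (i - length P))"
      using assms(2) unfolding valid_proof_def by blast
    then show ?thesis
      using False by (auto simp: nth_append)
  qed
qed

lemma valid_proof_snoc:
  assumes "valid_proof P" "infer js j" "set js \<subseteq> set P"
  shows "valid_proof (P @ [j])"
  using assms unfolding valid_proof_def by (auto simp: nth_append less_Suc_eq)

lemma derivable_premises: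
  assumes "\<And>j. j \<in> set js \<Longrightarrow> derivable j"
  shows "\<exists>P. valid_proof P \<and> set js \<subseteq> set P"
  using assms
proof (induction js)
  case Nil
  show ?case by (intro exI[of _ "[]"]) (simp add: valid_proof_def)
next
  case (Cons j js)
  obtain P Q where "valid_proof P" "set js \<subseteq> set P" "valid_proof Q" "j \<in> set Q"
    using Cons.IH Cons.prems unfolding derivable_def proves_def
    by (metis list.set_intros)
  then show ?case
    by (intro exI[of _ "P @ Q"]) (auto simp: valid_proof_append)
qed

lemma derivable_infer:
  assumes "infer js j" "\<And>i. i \<in> set js \<Longrightarrow> derivable i"
  shows "derivable j"
proof -
  obtain P where "valid_proof P" "set js \<subseteq> set P"
    using derivable_premises assms(2) by blast
  then have "valid_proof (P @ [j])"
    using assms(1) valid_proof_snoc by blast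
  then show ?thesis
    unfolding derivable_def proves_def by (intro exI[of _ "P @ [j]"]) simp
qed

lemma derivable_infer0: "infer [] j \<Longrightarrow> derivable j"
  by (rule derivable_infer) auto

lemma derivable_infer1: "infer [i] j \<Longrightarrow> derivable i \<Longrightarrow> derivable j"
  by (rule derivable_infer) auto

lemma derivable_infer2: "infer [i, i'] j \<Longrightarrow> derivable i \<Longrightarrow> derivable i' \<Longrightarrow> derivable j"
  by (rule derivable_infer) auto


section \<open>Terms with a provable value\<close>

definition has_value :: "trm fset \<Rightarrow> trm \<Rightarrow> nat \<Rightarrow> bool" where
  "has_value \<Gamma> t n \<longleftrightarrow> derivable (\<Gamma> \<turnstile> t \<doteq> num n)"

lemma has_value_tt: "has_value \<Gamma> a tt \<longleftrightarrow> derivable (\<Gamma> \<turnstile> a)"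
  unfolding has_value_def by (metis derivable_infer1 true_intro true_elim)

lemma has_value_ff: "has_value \<Gamma> a ff \<longleftrightarrow> derivable (\<Gamma> \<turnstile> \<^bold>\<not> a)"
  unfolding has_value_def by (metis derivable_infer1 false_intro false_elim)

lemma num_isN: "derivable (\<Gamma> \<turnstile> isN (num n))"
proof (induction n)
  case 0
  show ?case by (simp add: derivable_infer0[OF zero_isN])
next
  case (Suc n)
  then show ?case by (simp add: derivable_infer1[OF suc_isN])
qed

lemma num_distinct: "m \<noteq> n \<Longrightarrow> derivable (\<Gamma> \<turnstile> num m \<^bold>\<noteq> num n)"
proof (induction m arbitrary: n)
  case 0
  then obtain k where "n = Suc k"
    by (cases n) auto
  then show ?case
    using derivable_infer1[OF neq_sym derivable_infer1[OF suc_neq_0 num_isN[of \<Gamma> k]]] by simp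
next
  case (Suc m)
  show ?case
  proof (cases n)
    case 0
    then show ?thesis
      using derivable_infer1[OF suc_neq_0 num_isN[of \<Gamma> m]] by simp
  next
    case (Suc k)
    then show ?thesis
      using derivable_infer1[OF suc_neq] Suc.IH[of k] Suc.prems by simp
  qed
qed

lemma has_value_replace:
  assumes "has_value \<Gamma> a n" "derivable (\<Gamma> \<turnstile> subst v (num n) p)" "wft p"
  shows "derivable (\<Gamma> \<turnstile> subst v a p)"
  using derivable_infer2[OF eq_replace[OF assms(3)]] derivable_infer1[OF eq_sym]
    assms(1,2) unfolding has_value_def by metis

text \<open>
  Replacing both variables of \<open>Var 0 \<doteq> Var 0\<close> at once gives reflexivity of \<open>a\<close>; with one side fixed
  to \<open>a\<close>, Leibniz' law would ask for \<open>a\<close> to be well-formed.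
\<close>

lemma has_value_isN:
  assumes "has_value \<Gamma> a n"
  shows "derivable (\<Gamma> \<turnstile> isN a)"
  using has_value_replace[OF assms, where v = 0 and p = "isN (Var 0)"] num_isN by simp

lemma has_value_trans:
  assumes "derivable (\<Gamma> \<turnstile> a \<doteq> b)" "has_value \<Gamma> b n"
  shows "has_value \<Gamma> a n"
proof -
  have "derivable (\<Gamma> \<turnstile> b \<doteq> a)"
    using assms(1) by (rule derivable_infer1[OF eq_sym])
  then show ?thesis
    using derivable_infer2[OF eq_replace[of "Var 0 \<doteq> num n" \<Gamma> b a 0]] assms(2)
    unfolding has_value_def by simp
qed

text \<open>
  The conversion rule for equations asks for the reduct to be a number, which its value
  provides. The value is what carries the equation from reduct to redex.
\<close>

lemma has_value_expand:
  assumes "c \<triangleright> c'" "has_value \<Gamma> c' n"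
  shows "has_value \<Gamma> c n"
  using has_value_trans[OF derivable_infer1[OF conv_eq] assms(2)] has_value_isN assms by blast

lemma has_value_suc:
  assumes "has_value \<Gamma> a n"
  shows "has_value \<Gamma> (Sc a) (Suc n)"
  using has_value_replace[OF assms, where v = 0 and p = "Sc (Var 0) \<doteq> num (Suc n)"]
    num_isN[of \<Gamma> "Suc n"] unfolding has_value_def by simp

text \<open>
  Both sides are known to equal numerals, between which equality is decided; the numerals are
  then exchanged for the given terms one after the other.
\<close>

lemma has_value_eq:
  assumes a: "has_value \<Gamma> a m" and b: "has_value \<Gamma> b n" and "wft a"
  shows "has_value \<Gamma> (a \<doteq> b) (if m = n then tt else ff)"
proof -
  obtain v where v: "v \<notin> fv a"
    using ex_fresh[of "{a}"] by auto
  show ?thesis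
  proof (cases "m = n")
    case True
    then have "derivable (\<Gamma> \<turnstile> subst v (num n) (a \<doteq> Var v))"
      using a v by (simp add: has_value_def subst_not_free)
    from has_value_replace[OF b this] have "derivable (\<Gamma> \<turnstile> a \<doteq> b)"
      using assms v by (simp add: subst_not_free)
    then show ?thesis
      using True has_value_tt by simp
  next
    case False
    then have "derivable (\<Gamma> \<turnstile> subst v (num m) (Var v \<^bold>\<noteq> num n))"
      using num_distinct by simp
    from has_value_replace[OF a this] have "derivable (\<Gamma> \<turnstile> subst v (num n) (a \<^bold>\<noteq> Var v))"
      using v by (simp add: subst_not_free)
    from has_value_replace[OF b this] have "derivable (\<Gamma> \<turnstile> a \<^bold>\<noteq> b)"
      using assms v by (simp add: subst_not_free)
    then show ?thesis
      using False has_value_ff by simp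
  qed
qed


section \<open>Application spines\<close>

abbreviation apps :: "trm \<Rightarrow> trm list \<Rightarrow> trm" where
  "apps \<equiv> foldl (\<lambda>t u. t \<cdot> u)"

lemma wft_apps [simp]: "wft (apps t us) \<longleftrightarrow> wft t \<and> (\<forall>u \<in> set us. wft u)"
  by (induction us arbitrary: t) auto

lemma subst_apps: "subst v s (apps t us) = apps (subst v s t) (map (subst v s) us)"
  by (induction us arbitrary: t) auto

lemma hstep_apps: "t \<triangleright> t' \<Longrightarrow> apps t us \<triangleright> apps t' us"
  by (induction us arbitrary: t t') (auto intro: hstep_app)

text \<open>
  The replaced occurrence of \<open>num k\<close> is marked by a variable that is fresh for the rest of the
  spine, so that substitution leaves everything else unchanged.
\<close>

lemma has_value_rec_arg:
  assumes m: "has_value \<Gamma> m k" and val: "has_value \<Gamma> (apps (Rec \<cdot> g \<cdot> h \<cdot> num k) us) r"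
    and wf: "wft g" "wft h" "\<forall>u \<in> set us. wft u"
  shows "has_value \<Gamma> (apps (Rec \<cdot> g \<cdot> h \<cdot> m) us) r"
proof -
  obtain v where v: "\<And>t. t \<in> set (g # h # us) \<Longrightarrow> v \<notin> fv t"
    using ex_fresh by blast
  let ?p = "apps (Rec \<cdot> g \<cdot> h \<cdot> Var v) us \<doteq> num r"
  have us: "map (subst v s) us = us" for s
    using v by (auto intro!: map_idI subst_not_free)
  have p: "subst v s ?p = (apps (Rec \<cdot> g \<cdot> h \<cdot> s) us \<doteq> num r)" for s
    using v by (simp add: subst_apps us subst_not_free)
  have "derivable (\<Gamma> \<turnstile> subst v (num k) ?p)"
    using val unfolding p has_value_def .
  from has_value_replace[OF m this] have "derivable (\<Gamma> \<turnstile> subst v m ?p)"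
    using wf by simp
  then show ?thesis
    unfolding p has_value_def .
qed

lemma has_value_beta:
  assumes "wft u" "has_value \<Gamma> (apps (beta b u) us) r"
  shows "has_value \<Gamma> (apps (Lam b \<cdot> u) us) r"
  using has_value_expand[OF hstep_apps[OF hstep_beta]] assms .

lemma has_value_rec_zero:
  assumes "has_value \<Gamma> m 0" "has_value \<Gamma> (apps g us) r"
    and "wft g" "wft h" "\<forall>u \<in> set us. wft u"
  shows "has_value \<Gamma> (apps (Rec \<cdot> g \<cdot> h \<cdot> m) us) r"
  using has_value_expand[OF hstep_apps[OF hstep_zero]] has_value_rec_arg[OF assms(1)] assms by simp

lemma has_value_rec_suc:
  assumes "has_value \<Gamma> m (Suc k)"
    and "has_value \<Gamma> (apps (h \<cdot> num k \<cdot> (Rec \<cdot> g \<cdot> h \<cdot> num k)) us) r"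
    and "wft g" "wft h" "\<forall>u \<in> set us. wft u"
  shows "has_value \<Gamma> (apps (Rec \<cdot> g \<cdot> h \<cdot> m) us) r"
  using has_value_expand[OF hstep_apps[OF hstep_suc]] has_value_rec_arg[OF assms(1)] assms by simp


section \<open>Soundness of evaluation\<close>

primrec head_trm :: "head \<Rightarrow> trm" where
  "head_trm (HLam b) = Lam b"
| "head_trm HRec = Rec"
| "head_trm (HRec1 g) = Rec \<cdot> g"
| "head_trm (HRec2 g h) = Rec \<cdot> g \<cdot> h"
| "head_trm HAll = All"

text \<open>
  Provable replaceability of \<open>w\<close> by \<open>t\<close> in function position. It takes the place of an equation
  between terms that are functions rather than numbers.
\<close>

definition represents :: "trm fset \<Rightarrow> trm \<Rightarrow> trm \<Rightarrow> bool" where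
  "represents \<Gamma> t w \<longleftrightarrow>
     (\<forall>us r. (\<forall>u \<in> set us. wft u) \<longrightarrow> has_value \<Gamma> (apps w us) r \<longrightarrow> has_value \<Gamma> (apps t us) r)"

lemma representsI:
  "(\<And>us r. \<forall>u \<in> set us. wft u \<Longrightarrow> has_value \<Gamma> (apps w us) r \<Longrightarrow> has_value \<Gamma> (apps t us) r) \<Longrightarrow>
   represents \<Gamma> t w"
  by (simp add: represents_def)

lemma represents_refl: "represents \<Gamma> t t"
  by (simp add: represents_def)

lemma representsD:
  "represents \<Gamma> t w \<Longrightarrow> has_value \<Gamma> (apps (w \<cdot> u) us) r \<Longrightarrow> wft u \<Longrightarrow> \<forall>u \<in> set us. wft u \<Longrightarrow>
   has_value \<Gamma> (apps (t \<cdot> u) us) r"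
  unfolding represents_def by (drule spec[of _ "u # us"]) simp

text \<open>
  The common shape of the three head clauses that compute: \<open>t\<close> has head \<open>w'\<close>, the application
  \<open>w' \<cdot> u\<close> reduces to \<open>a\<close> (for the recursor, once \<open>u\<close> is replaced by its value), and the
  evaluation continues with \<open>a\<close>. In the last
  assumption \<open>us\<close> varies because the reduction takes place at the front of an arbitrary spine.
\<close>

lemma represents_expand:
  assumes t: "represents \<Gamma> t w'" and a: "represents \<Gamma> a w" and "wft u"
    and step: "\<And>us r. \<forall>u \<in> set us. wft u \<Longrightarrow> has_value \<Gamma> (apps a us) r \<Longrightarrow>
                        has_value \<Gamma> (apps (w' \<cdot> u) us) r"
  shows "represents \<Gamma> (t \<cdot> u) w"
proof (rule representsI)
  fix us r assume us: "\<forall>u \<in> set us. wft u" and "has_value \<Gamma> (apps w us) r"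
  then have "has_value \<Gamma> (apps a us) r"
    using a by (simp add: represents_def)
  then have "has_value \<Gamma> (apps (w' \<cdot> u) us) r"
    using step us by blast
  then show "has_value \<Gamma> (apps (t \<cdot> u) us) r"
    using t us \<open>wft u\<close> by (blast intro: representsD)
qed

lemma representsD1:
  "represents \<Gamma> t w \<Longrightarrow> has_value \<Gamma> (w \<cdot> u) r \<Longrightarrow> wft u \<Longrightarrow> has_value \<Gamma> (t \<cdot> u) r"
  using representsD[where us = "[]"] by simp

lemma represents_app: "represents \<Gamma> t w \<Longrightarrow> wft u \<Longrightarrow> represents \<Gamma> (t \<cdot> u) (w \<cdot> u)"
  unfolding represents_def[of \<Gamma> "t \<cdot> u"] using representsD by blast

text \<open>
  Well-formedness of the head is part of the induction because the arguments collected in it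
  (\<open>g\<close>, \<open>h\<close> and the body of an abstraction) are evaluated later, when the induction hypotheses
  and the recursor rules ask for well-formed terms.
\<close>

lemma evaluation_sound:
  "ev gn s t r \<Longrightarrow> wft t \<Longrightarrow> has_value {||} t r"
  "hd_ev gn s t w \<Longrightarrow> wft t \<Longrightarrow> wft (head_trm w) \<and> represents {||} t (head_trm w)"
proof (induction rule: ev_hd_ev.inducts)
  case (ev_zero s)
  show ?case using num_isN[of "{||}" 0] by (simp add: has_value_def)
next
  case (ev_suc s a n)
  then show ?case using has_value_suc by (simp flip: Suc_eq_plus1)
next
  case (ev_eq s a m b n)
  then show ?case using has_value_eq by simp
next
  case (ev_neg_ff s a)
  then show ?case by (simp add: has_value_tt has_value_ff)
next
  case (ev_neg_tt s a)
  then show ?case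
    using derivable_infer1[OF negneg_intro] by (simp add: has_value_tt has_value_ff)
next
  case (ev_or_tt1 s a b)
  then show ?case
    using derivable_infer1[OF or_intro1] by (simp add: has_value_tt)
next
  case (ev_or_tt2 s b a)
  then show ?case
    using derivable_infer1[OF or_intro2] by (simp add: has_value_tt)
next
  case (ev_or_ff s a b)
  then show ?case
    using derivable_infer2[OF neg_or_intro] by (simp add: has_value_ff)
next
  case (ev_beta s t b u r)
  then have "has_value {||} (Lam b \<cdot> u) r"
    by (intro has_value_beta[where us = "[]", simplified]) (simp_all add: wft_inst)
  with ev_beta show ?case
    by (auto intro: representsD1)
next
  case (ev_rec_zero s t g h m r)
  then have "has_value {||} (Rec \<cdot> g \<cdot> h \<cdot> m) r"
    by (intro has_value_rec_zero[where us = "[]", simplified]) simp_all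
  with ev_rec_zero show ?case
    by (auto intro: representsD1)
next
  case (ev_rec_suc s t g h m k r)
  then have "has_value {||} (Rec \<cdot> g \<cdot> h \<cdot> m) r"
    by (intro has_value_rec_suc[where us = "[]" and k = k, simplified]) (simp_all flip: Suc_eq_plus1)
  with ev_rec_suc show ?case
    by (auto intro: representsD1)
next
  case (ev_all_tt s t P u)
  then have "derivable ({|isN (Var 0)|} \<turnstile> \<up>u \<cdot> Var 0)"
    unfolding derivable_def by blast
  then have "has_value {||} (All \<cdot> u) tt"
    using derivable_infer1[OF all_intro, of "{||}" u] by (simp add: has_value_tt)
  with ev_all_tt show ?case
    by (auto intro: representsD1)
next
  case (ev_all_ff s t P u i)
  then have "derivable ({||} \<turnstile> \<^bold>\<not> (u \<cdot> num i))"
    unfolding derivable_def by blast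
  then have "has_value {||} (All \<cdot> u) ff"
    using derivable_infer2[OF neg_all_intro] num_isN has_value_ff by blast
  with ev_all_ff show ?case
    by (auto intro: representsD1)
next
  case (hd_rec1 s t g)
  then show ?case using represents_app[of "{||}" t] by fastforce
next
  case (hd_rec2 s t g h)
  then show ?case using represents_app[of "{||}" t] by fastforce
next
  case (hd_beta s t b u w)
  have "represents {||} (t \<cdot> u) (head_trm w)"
  proof (rule represents_expand[of _ _ "Lam b" "beta b u"])
    show "has_value {||} (apps (Lam b \<cdot> u) us) r" if "has_value {||} (apps (beta b u) us) r" for us r
      using hd_beta.prems that by (intro has_value_beta) simp_all
  qed (use hd_beta in \<open>simp_all add: wft_inst\<close>)
  then show ?case
    using hd_beta by (simp add: wft_inst)
next
  case (hd_rec_zero s t g h m w)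
  have "represents {||} (t \<cdot> m) (head_trm w)"
  proof (rule represents_expand[of _ _ "Rec \<cdot> g \<cdot> h" g])
    show "has_value {||} (apps (Rec \<cdot> g \<cdot> h \<cdot> m) us) r"
      if "\<forall>u \<in> set us. wft u" "has_value {||} (apps g us) r" for us r
      using hd_rec_zero that by (intro has_value_rec_zero) simp_all
  qed (use hd_rec_zero in simp_all)
  then show ?case
    using hd_rec_zero by simp
next
  case (hd_rec_suc s t g h m k w)
  let ?a = "h \<cdot> num k \<cdot> (Rec \<cdot> g \<cdot> h \<cdot> num k)"
  have "represents {||} (t \<cdot> m) (head_trm w)"
  proof (rule represents_expand[of _ _ "Rec \<cdot> g \<cdot> h" ?a])
    show "has_value {||} (apps (Rec \<cdot> g \<cdot> h \<cdot> m) us) r"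
      if "\<forall>u \<in> set us. wft u" "has_value {||} (apps ?a us) r" for us r
      using hd_rec_suc that by (intro has_value_rec_suc[where k = k]) (simp_all flip: Suc_eq_plus1)
  qed (use hd_rec_suc in simp_all)
  then show ?case
    using hd_rec_suc by simp
qed (simp_all add: represents_refl)

theorem corollary4p1:
  fixes gn :: "sequent list \<Rightarrow> nat" and c :: trm and s :: nat
  assumes "inj_on gn {P. valid_proof P}"
    and "wft c"
    and "ev gn s c tt"
  shows "derivable ({||} \<turnstile> c)"
  using evaluation_sound(1)[OF assms(3,2)] by (simp add: has_value_tt)

end
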